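(* Let $\{A(t)\}_{t\ge0}$ be a discrete time chain of $N\times N$ row-stochastic matrices and let $t_0\ge0$ be an integer. For the opinion network $x(t+1)=A(t)x(t)$, $t\ge t_0$, the size of the smallest Éminence Grise Coalition (EGC) is $N-\dim(\mathbf{null}_{t_0}(A))$.
   Context: Time indices are non-negative integers; $\mathcal V=\{1,\dots,N\}$. A discrete time chain is a sequence $\{A(t)\}_{t\ge0}$ of $N\times N$ row-stochastic matrices (non-negative entries, each row summing to 1). Its state transition matrix is $\Phi(t,\tau)=A(t-1)\cdots A(\tau)$ for $t>\tau\ge0$, and $\Phi(t,t)=I$. For $\tau\ge0$, $\mathbf{null}_\tau(A)=\{v\in\mathbb R^N:\lim_{t\to\infty}\Phi(t,\tau)v=\mathbf 0_N\}$, a vector subspace of $\mathbb R^N$. EGC: for the network with initial time $t_0$, a subset $\mathcal S\subset\mathcal V$ is an EGC if for every $x^*\in\mathbb R$ and every choice of initial values $x_i(t_0)$, $i\in\mathcal V\setminus\mathcal S$, there is a choice of initial values $x_i(t_0)$, $i\in\mathcal S$, such that $\lim_{t\to\infty}x(t)=x^*\mathbf 1_N$, where $\mathbf 1_N$ is the all-ones vector. *)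

theory Defs
  imports "HOL-Analysis.Analysis"
begin

definition row_stochastic :: "real^'n^'n \<Rightarrow> bool" where
  "row_stochastic M \<longleftrightarrow> (\<forall>i j. 0 \<le> M $ i $ j) \<and> (\<forall>i. (\<Sum>j\<in>UNIV. M $ i $ j) = 1)"

definition discrete_time_chain :: "(nat \<Rightarrow> real^'n^'n) \<Rightarrow> bool" where
  "discrete_time_chain A \<longleftrightarrow> (\<forall>t. row_stochastic (A t))"

(* transition A t tau = A(t-1) ** ... ** A(tau) for t > tau, and the identity for t = tau.
   The value for t < tau is a convention (identity) and is never used. *)
primrec transition :: "(nat \<Rightarrow> real^'n^'n) \<Rightarrow> nat \<Rightarrow> nat \<Rightarrow> real^'n^'n" where
  "transition A 0 \<tau> = mat 1"
| "transition A (Suc t) \<tau> = (if \<tau> \<le> t then A t ** transition A t \<tau> else mat 1)"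

definition null_space :: "(nat \<Rightarrow> real^'n^'n) \<Rightarrow> nat \<Rightarrow> (real^'n) set" where
  "null_space A \<tau> = {v. (\<lambda>t. transition A t \<tau> *v v) \<longlonglongrightarrow> 0}"

(* The values of x before the initial time t0 are unconstrained and irrelevant. *)
definition opinion_network :: "(nat \<Rightarrow> real^'n^'n) \<Rightarrow> nat \<Rightarrow> (nat \<Rightarrow> real^'n) \<Rightarrow> bool" where
  "opinion_network A t0 x \<longleftrightarrow> (\<forall>t\<ge>t0. x (Suc t) = A t *v x t)"

(* u prescribes the initial values outside S (its values on S are ignored). The trajectory x
   from t0 on is determined by x t0, so choosing x amounts to choosing the values x t0 $ i, i in S. *)
definition EGC :: "(nat \<Rightarrow> real^'n^'n) \<Rightarrow> nat \<Rightarrow> 'n set \<Rightarrow> bool" where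
  "EGC A t0 S \<longleftrightarrow>
     (\<forall>(c::real) (u::'n \<Rightarrow> real). \<exists>x. opinion_network A t0 x \<and>
        (\<forall>i. i \<notin> S \<longrightarrow> x t0 $ i = u i) \<and> x \<longlonglongrightarrow> c *\<^sub>R (\<chi> i. 1))"

end

(* Row-stochastic matrices fix the all-ones vector, so after subtracting x^* 1 from the initial
   state, S is an EGC iff every prescription of coordinates outside S extends to a vector of the
   null space V, i.e. iff V together with the unit vectors e_i, i in S, spans the whole space.
   Such an S has at least N - dim V elements, and completing a basis of V by unit vectors
   attains this bound. *)
theory Submission
  imports Defs
begin

lemma row_stochastic_mult_ones:
  fixes M :: "real^'n^'n"
  assumes "row_stochastic M"
  shows "M *v (\<chi> i. 1) = (\<chi> i. 1)"
  using assms by (simp add: row_stochastic_def matrix_vector_mult_def vec_eq_iff)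

lemma transition_mult_ones:
  fixes A :: "nat \<Rightarrow> real^'n^'n"
  assumes "discrete_time_chain A"
  shows "transition A t \<tau> *v (\<chi> i. 1) = (\<chi> i. 1)"
proof (induction t)
  case (Suc t)
  have "row_stochastic (A t)"
    using assms by (simp add: discrete_time_chain_def)
  with Suc show ?case
    by (simp add: row_stochastic_mult_ones flip: matrix_vector_mul_assoc)
qed simp

lemma transition_self [simp]: "transition A t t = mat 1"
  by (cases t) simp_all

lemma opinion_network_transition:
  assumes "opinion_network A t0 x" and "t0 \<le> t"
  shows "x t = transition A t t0 *v x t0"
  using assms(2)
proof (induction t rule: dec_induct)
  case (step t)
  with assms(1) show ?case
    by (simp add: opinion_network_def matrix_vector_mul_assoc)
qed simp

lemma opinion_network_transition_orbit:
  "opinion_network A t0 (\<lambda>t. transition A t t0 *v v)"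
  by (simp add: opinion_network_def matrix_vector_mul_assoc)

lemma subspace_null_space:
  fixes A :: "nat \<Rightarrow> real^'n^'n"
  shows "subspace (null_space A \<tau>)"
proof (rule subspaceI)
  fix v w :: "real^'n" and c :: real
  assume v: "v \<in> null_space A \<tau>"
  show "c *\<^sub>R v \<in> null_space A \<tau>"
    using v tendsto_scaleR[OF tendsto_const, of "\<lambda>t. transition A t \<tau> *v v" 0 sequentially c]
    by (simp add: null_space_def matrix_vector_mult_scaleR)
  assume "w \<in> null_space A \<tau>"
  with v show "v + w \<in> null_space A \<tau>"
    using tendsto_add[of "\<lambda>t. transition A t \<tau> *v v" 0 sequentially "\<lambda>t. transition A t \<tau> *v w" 0]
    by (simp add: null_space_def matrix_vector_right_distrib)
qed (simp add: null_space_def)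

text \<open>The transition matrices fix the all-ones vector, so the orbit of the shifted vector is
  the orbit of \<open>v\<close> minus a constant sequence. Consensus at any level \<open>c\<close>
  thus becomes convergence to 0.\<close>

lemma tendsto_consensus_iff_null_space:
  fixes A :: "nat \<Rightarrow> real^'n^'n"
  assumes "discrete_time_chain A"
  shows "(\<lambda>t. transition A t \<tau> *v v) \<longlonglongrightarrow> c *\<^sub>R (\<chi> i. 1) \<longleftrightarrow>
         v - c *\<^sub>R (\<chi> i. 1) \<in> null_space A \<tau>"
  by (subst LIM_zero_iff[symmetric])
     (simp add: null_space_def matrix_vector_mult_diff_distrib matrix_vector_mult_scaleR
        transition_mult_ones[OF assms])

lemma EGC_iff_null_space:
  fixes A :: "nat \<Rightarrow> real^'n^'n"
  assumes chain: "discrete_time_chain A"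
  shows "EGC A t0 S \<longleftrightarrow> (\<forall>w. \<exists>z\<in>null_space A t0. \<forall>i. i \<notin> S \<longrightarrow> z $ i = w $ i)"
proof
  assume egc: "EGC A t0 S"
  show "\<forall>w. \<exists>z\<in>null_space A t0. \<forall>i. i \<notin> S \<longrightarrow> z $ i = w $ i"
  proof
    fix w :: "real^'n"
    obtain x where net: "opinion_network A t0 x" and off: "\<forall>i. i \<notin> S \<longrightarrow> x t0 $ i = w $ i"
      and lim: "x \<longlonglongrightarrow> 0"
      \<comment> \<open>The target 0 is enough here: a trajectory that tends to 0 starts in the null
        space, and the values off \<open>S\<close> are still arbitrary.\<close>
      using egc[unfolded EGC_def, THEN spec, of 0, THEN spec, of "\<lambda>i. w $ i"] by auto
    \<comment> \<open>The trajectory is an orbit only from \<open>t0\<close> on, so the two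
      sequences agree eventually rather than everywhere.\<close>
    have "\<forall>\<^sub>F t in sequentially. x t = transition A t t0 *v x t0"
      unfolding eventually_sequentially using opinion_network_transition[OF net] by blast
    with lim have "(\<lambda>t. transition A t t0 *v x t0) \<longlonglongrightarrow> 0"
      by (rule Lim_transform_eventually)
    then have "x t0 \<in> null_space A t0"
      by (simp add: null_space_def)
    with off show "\<exists>z\<in>null_space A t0. \<forall>i. i \<notin> S \<longrightarrow> z $ i = w $ i"
      by blast
  qed
next
  assume ext: "\<forall>w. \<exists>z\<in>null_space A t0. \<forall>i. i \<notin> S \<longrightarrow> z $ i = w $ i"
  show "EGC A t0 S"
    unfolding EGC_def
  proof (intro allI)
    fix c :: real and u :: "'n \<Rightarrow> real"
    \<comment> \<open>The prescription is lowered by \<open>c\<close>, so that adding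
      \<open>c\<close> times the all-ones vector to \<open>z\<close> restores \<open>u\<close> off
      \<open>S\<close> and moves the limit from 0 to the target.\<close>
    obtain z where z: "z \<in> null_space A t0" and off: "\<forall>i. i \<notin> S \<longrightarrow> z $ i = u i - c"
      using ext[rule_format, of "\<chi> i. u i - c"] by auto
    define x where "x t = transition A t t0 *v (z + c *\<^sub>R (\<chi> i. 1))" for t
    have "x \<longlonglongrightarrow> c *\<^sub>R (\<chi> i. 1)"
      unfolding x_def using z by (simp add: tendsto_consensus_iff_null_space[OF chain])
    moreover have "opinion_network A t0 x"
      unfolding x_def by (rule opinion_network_transition_orbit)
    moreover have "\<forall>i. i \<notin> S \<longrightarrow> x t0 $ i = u i"
      using off by (simp add: x_def)
    ultimately show "\<exists>x. opinion_network A t0 x \<and> (\<forall>i. i \<notin> S \<longrightarrow> x t0 $ i = u i) \<and>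
        x \<longlonglongrightarrow> c *\<^sub>R (\<chi> i. 1)"
      by blast
  qed
qed

lemma span_axis_image:
  fixes S :: "'n::finite set"
  shows "span ((\<lambda>i. axis i (1::real)) ` S) = {x. \<forall>i. i \<notin> S \<longrightarrow> x $ i = 0}"
proof
  have "subspace {x::real^'n. \<forall>i. i \<notin> S \<longrightarrow> x $ i = 0}"
    by (auto simp: subspace_def)
  then show "span ((\<lambda>i. axis i (1::real)) ` S) \<subseteq> {x. \<forall>i. i \<notin> S \<longrightarrow> x $ i = 0}"
    by (rule span_minimal[rotated]) (auto simp: axis_def)
next
  show "{x. \<forall>i. i \<notin> S \<longrightarrow> x $ i = 0} \<subseteq> span ((\<lambda>i. axis i (1::real)) ` S)"
  proof
    fix x :: "real^'n"
    assume "x \<in> {x. \<forall>i. i \<notin> S \<longrightarrow> x $ i = 0}"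
    then have "x = (\<Sum>i\<in>S. x $ i *\<^sub>R axis i 1)"
      by (auto simp: vec_eq_iff axis_def if_distrib sum.If_cases cong: if_cong)
    also have "\<dots> \<in> span ((\<lambda>i. axis i 1) ` S)"
      by (intro span_sum span_scale span_base) auto
    finally show "x \<in> span ((\<lambda>i. axis i 1) ` S)" .
  qed
qed

text \<open>The span is the sum of \<open>V\<close> and the space of vectors vanishing off
  \<open>S\<close>. A vector \<open>w\<close> lies in this sum iff \<open>w - z\<close> vanishes off
  \<open>S\<close> for some \<open>z\<close> in \<open>V\<close>, which says that \<open>z\<close>
  agrees with \<open>w\<close> there.\<close>

lemma prescribe_coordinates_iff_span:
  fixes V :: "(real^'n) set"
  assumes "subspace V"
  shows "(\<forall>w. \<exists>z\<in>V. \<forall>i. i \<notin> S \<longrightarrow> z $ i = w $ i) \<longleftrightarrow>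
         span (V \<union> (\<lambda>i. axis i 1) ` S) = UNIV"
proof -
  have "w \<in> span (V \<union> (\<lambda>i. axis i 1) ` S) \<longleftrightarrow> (\<exists>z\<in>V. \<forall>i. i \<notin> S \<longrightarrow> z $ i = w $ i)" for w
  proof -
    have "w \<in> span (V \<union> (\<lambda>i. axis i 1) ` S) \<longleftrightarrow>
        (\<exists>z\<in>V. w - z \<in> span ((\<lambda>i. axis i 1) ` S))"
    proof -
      have "span V = V"
        using assms by simp
      moreover have "w = z + y \<longleftrightarrow> y = w - z" for z y
        by auto
      ultimately show ?thesis
        by (auto simp only: span_Un mem_Collect_eq)
    qed
    then show ?thesis
      by (simp add: span_axis_image eq_commute[of "w $ _"])
  qed
  then show ?thesis
    by blast
qed

lemma card_ge_codim_of_span_axis: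
  fixes V :: "(real^'n) set"
  assumes "span (V \<union> (\<lambda>i. axis i 1) ` S) = UNIV"
  shows "CARD('n) - dim V \<le> card S"
proof -
  \<comment> \<open>Replacing \<open>V\<close> by a basis keeps the span and leaves a finite
    spanning set, of at most \<open>dim V + card S\<close> elements.\<close>
  obtain B where B: "B \<subseteq> V" "independent B" "V \<subseteq> span B" "card B = dim V"
    using basis_exists by blast
  have "V \<union> (\<lambda>i. axis i 1) ` S \<subseteq> span (B \<union> (\<lambda>i. axis i 1) ` S)"
    using B(3) span_mono[of B "B \<union> (\<lambda>i. axis i 1) ` S"] by (auto intro: span_base)
  then have "UNIV \<subseteq> span (B \<union> (\<lambda>i. axis i 1) ` S)"
    using assms span_minimal by (metis subspace_span)
  then have "dim (UNIV :: (real^'n) set) \<le> card (B \<union> (\<lambda>i. axis i 1) ` S)"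
    using independent_imp_finite[OF B(2)] by (intro dim_le_card) auto
  also have "\<dots> \<le> card B + card S"
    using card_Un_le[of B "(\<lambda>i. axis i 1) ` S"] card_image_le[of S "\<lambda>i. axis i (1::real)"]
    by simp
  finally show ?thesis
    using B(4) by simp
qed

text \<open>This is Steinitz extension: a basis of \<open>V\<close> grows to a basis of the whole
  space by unit vectors alone, and \<open>S\<close> collects their indices.\<close>

lemma exists_axis_complement:
  fixes V :: "(real^'n) set"
  shows "\<exists>S. span (V \<union> (\<lambda>i. axis i 1) ` S) = UNIV \<and> card S = CARD('n) - dim V"
proof -
  obtain B where B: "B \<subseteq> V" "independent B" "V \<subseteq> span B" "card B = dim V"
    using basis_exists by blast
  \<comment> \<open>\<open>C\<close> is a maximal independent set between \<open>B\<close> and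
    \<open>B\<close> together with all unit vectors. Its span contains every unit vector, so it is a
    basis of the whole space.\<close>
  obtain C where C: "B \<subseteq> C" "C \<subseteq> B \<union> range (\<lambda>i. axis i 1)" "independent C"
      "B \<union> range (\<lambda>i. axis i 1) \<subseteq> span C"
    using maximal_independent_subset_extend[OF _ B(2), of "B \<union> range (\<lambda>i. axis i 1)"] by blast
  have "span (range (\<lambda>i. axis i 1)) \<subseteq> span C"
    using C(4) by (intro span_minimal subspace_span) simp
  then have spanC: "span C = UNIV"
    by (auto simp: span_axis_image)
  then have cardC: "card C = CARD('n)"
    using dim_eq_card_independent[OF C(3)] dim_span[of C] by simp
  \<comment> \<open>Unit vectors that already belong to \<open>B\<close> are left out, so
    \<open>C\<close> is the disjoint union of \<open>B\<close> and the unit vectors indexed by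
    \<open>S\<close>. Distinct indices give distinct unit vectors, hence \<open>card S\<close> is
    the number of added vectors.\<close>
  define S where "S = {i::'n. axis i 1 \<in> C - B}"
  have image: "(\<lambda>i. axis i 1) ` S = C - B"
    using C(2) by (auto simp: S_def)
  have "inj_on (\<lambda>i. axis i (1::real)) S"
    by (auto simp: inj_on_def axis_eq_axis)
  then have "card S = card (C - B)"
    using card_image image by metis
  also have "\<dots> = CARD('n) - dim V"
    using C(1) B(2,4) cardC by (simp add: card_Diff_subset independent_imp_finite)
  finally have "card S = CARD('n) - dim V" .
  moreover have "span (V \<union> (\<lambda>i. axis i 1) ` S) = UNIV"
    using span_mono[of C "V \<union> (C - B)"] B(1) spanC by (auto simp: image)
  ultimately show ?thesis
    by blast
qed

theorem theorem6:
  fixes A :: "nat \<Rightarrow> real^'n^'n" and t0 :: nat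
  assumes "discrete_time_chain A"
  shows "(\<exists>S. EGC A t0 S \<and> card S = CARD('n) - dim (null_space A t0)) \<and>
         (\<forall>S. EGC A t0 S \<longrightarrow> CARD('n) - dim (null_space A t0) \<le> card S)"
proof -
  have "EGC A t0 S \<longleftrightarrow> span (null_space A t0 \<union> (\<lambda>i. axis i 1) ` S) = UNIV" for S
    using EGC_iff_null_space[OF assms] prescribe_coordinates_iff_span[OF subspace_null_space]
    by simp
  then show ?thesis
    using exists_axis_complement card_ge_codim_of_span_axis by auto
qed

end
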